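(* Let $G=G([n],E)$ be a simple graph and let $$P_G:=\Big\{x\in\mathbb{R}^{[n]}:\ \sum_{i\in[n]}x_i=n+|E|\ \text{ and }\ \sum_{i\in\sigma}x_i\ \ge\ |\sigma|+|E(G[\sigma])|\ \text{ for all }\sigma\subseteq[n]\Big\}.$$ Then the face complex of the polytope $P_G$ is a polytopal complex realization of the abstract cell complex $\mathscr{Z}_G$: there is a bijection between the nonempty faces of $P_G$ and the partial acyclic orientations of $G$ such that, if the faces $F,F'$ correspond to $O,O'$, then $F\subseteq F'$ if and only if $O\preceq_z O'$, and the affine dimension of $F$ equals $\dim_G(O)$.
   Context: Let $G=G(V,E)$ be a finite simple graph, and write $G[\sigma]$ for the subgraph induced on $\sigma\subseteq V$. An orientation of $G$ is a function $O$ assigning to each edge $e=\{u,v\}$ one of $e$ (the edge is left undirected), $(u,v)$, or $(v,u)$. A partition $\Sigma$ of $V$ is a connected partition of $G$ if $G[\sigma]$ is connected for every block $\sigma\in\Sigma$. The partition graph $G^\Sigma$ has vertex set $\Sigma$, and two distinct blocks $\sigma,\rho$ are adjacent iff some edge of $G$ joins a vertex of $\sigma$ to a vertex of $\rho$. An acyclic orientation of a graph orients every edge and has no directed cycle; it induces a partial order on the vertices (transitive closure, where $(a,b)$ means $a<b$). An orientation $O$ of $G$ is a partial acyclic orientation (p.a.o.) of $G$ if there exist a connected partition $\Sigma$ of $G$ and an acyclic orientation $O^\Sigma$ of $G^\Sigma$ such that every edge contained in a block of $\Sigma$ is left undirected by $O$, and every edge $\{u,v\}$ with $u\in\sigma$,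 $v\in\rho$, $\sigma\neq\rho$, satisfies $O(\{u,v\})=(u,v)$ whenever $O^\Sigma(\{\sigma,\rho\})=(\sigma,\rho)$. For such $O$ put $\dim_G(O)=|V|-|\Sigma|$, and let $J_G(O)$ be the collection of all subsets $\bigcup_{\sigma\in I}\sigma\subseteq V$, where $I$ ranges over the order ideals (down-closed subsets, including $\emptyset$) of the poset on $\Sigma$ induced by $O^\Sigma$. The abstract cell complex $\mathscr{Z}_G$ has as cells the p.a.o.'s of $G$, with order $O_1\preceq_z O_2$ iff $J_G(O_2)\subseteq J_G(O_1)$, and dimension function $\dim_G$. *)

theory Defs
  imports "HOL-Analysis.Analysis" "HOL-Library.Disjoint_Sets" "HOL-Library.FuncSet"
begin

definition simple_graph :: "'a set \<Rightarrow> 'a set set \<Rightarrow> bool" where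
  "simple_graph V E \<longleftrightarrow> finite V \<and> (\<forall>e\<in>E. e \<subseteq> V \<and> card e = 2)"

definition induced_edges :: "'a set set \<Rightarrow> 'a set \<Rightarrow> 'a set set" where
  "induced_edges E \<sigma> = {e \<in> E. e \<subseteq> \<sigma>}"

definition connected_graph :: "'a set \<Rightarrow> 'a set set \<Rightarrow> bool" where
  "connected_graph V E \<longleftrightarrow> V \<noteq> {} \<and> (\<forall>u\<in>V. \<forall>v\<in>V. (u, v) \<in> {(a, b). {a, b} \<in> E}\<^sup>*)"

definition connected_partition :: "'a set \<Rightarrow> 'a set set \<Rightarrow> 'a set set \<Rightarrow> bool" where
  "connected_partition V E \<Sigma> \<longleftrightarrow>
     partition_on V \<Sigma> \<and> (\<forall>\<sigma>\<in>\<Sigma>. connected_graph \<sigma> (induced_edges E \<sigma>))"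

definition partition_graph_edges :: "'a set set \<Rightarrow> 'a set set \<Rightarrow> 'a set set set" where
  "partition_graph_edges E \<Sigma> =
     {{\<sigma>, \<rho>} | \<sigma> \<rho>. \<sigma> \<in> \<Sigma> \<and> \<rho> \<in> \<Sigma> \<and> \<sigma> \<noteq> \<rho> \<and> (\<exists>u\<in>\<sigma>. \<exists>v\<in>\<rho>. {u, v} \<in> E)}"

datatype 'a edge_orient = Undirected "'a set" | Directed 'a 'a

text \<open>Orientations are extensional functions, so that two of them are equal iff they agree on
  all edges.\<close>

definition orientations :: "'a set set \<Rightarrow> ('a set \<Rightarrow> 'a edge_orient) set" where
  "orientations E = (\<Pi>\<^sub>E e\<in>E. insert (Undirected e) {Directed u v | u v. e = {u, v}})"

definition arcs :: "'a set set \<Rightarrow> ('a set \<Rightarrow> 'a edge_orient) \<Rightarrow> ('a \<times> 'a) set" where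
  "arcs E \<omega> = {(u, v). {u, v} \<in> E \<and> \<omega> {u, v} = Directed u v}"

definition acyclic_orientation :: "'a set set \<Rightarrow> ('a set \<Rightarrow> 'a edge_orient) \<Rightarrow> bool" where
  "acyclic_orientation E \<omega> \<longleftrightarrow>
     \<omega> \<in> orientations E \<and> (\<forall>e\<in>E. \<omega> e \<noteq> Undirected e) \<and> acyclic (arcs E \<omega>)"

definition pao_witness ::
  "'a set \<Rightarrow> 'a set set \<Rightarrow> ('a set \<Rightarrow> 'a edge_orient) \<Rightarrow> 'a set set \<Rightarrow>
     ('a set set \<Rightarrow> 'a set edge_orient) \<Rightarrow> bool" where
  "pao_witness V E \<omega> \<Sigma> \<Omega> \<longleftrightarrow>
     connected_partition V E \<Sigma> \<and>
     acyclic_orientation (partition_graph_edges E \<Sigma>) \<Omega> \<and>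
     (\<forall>\<sigma>\<in>\<Sigma>. \<forall>e\<in>E. e \<subseteq> \<sigma> \<longrightarrow> \<omega> e = Undirected e) \<and>
     (\<forall>\<sigma>\<in>\<Sigma>. \<forall>\<rho>\<in>\<Sigma>. \<forall>u\<in>\<sigma>. \<forall>v\<in>\<rho>. \<sigma> \<noteq> \<rho> \<and> {u, v} \<in> E \<and> \<Omega> {\<sigma>, \<rho>} = Directed \<sigma> \<rho> \<longrightarrow>
        \<omega> {u, v} = Directed u v)"

definition paos :: "'a set \<Rightarrow> 'a set set \<Rightarrow> ('a set \<Rightarrow> 'a edge_orient) set" where
  "paos V E = {\<omega> \<in> orientations E. \<exists>\<Sigma> \<Omega>. pao_witness V E \<omega> \<Sigma> \<Omega>}"

text \<open>The connected partition and the acyclic orientation of its partition graph are determined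
  by the partial acyclic orientation, which justifies the definite descriptions below.\<close>

lemma pao_witness_arc:
  assumes "pao_witness V E \<omega> \<Sigma> \<Omega>"
    and "\<sigma> \<in> \<Sigma>" "\<rho> \<in> \<Sigma>" "u \<in> \<sigma>" "v \<in> \<rho>" "\<sigma> \<noteq> \<rho>" "{u, v} \<in> E" "\<Omega> {\<sigma>, \<rho>} = Directed \<sigma> \<rho>"
  shows "\<omega> {u, v} = Directed u v"
proof -
  have "\<forall>\<sigma>\<in>\<Sigma>. \<forall>\<rho>\<in>\<Sigma>. \<forall>u\<in>\<sigma>. \<forall>v\<in>\<rho>. \<sigma> \<noteq> \<rho> \<and> {u, v} \<in> E \<and> \<Omega> {\<sigma>, \<rho>} = Directed \<sigma> \<rho> \<longrightarrow>
        \<omega> {u, v} = Directed u v"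
    using assms(1) unfolding pao_witness_def by (elim conjE)
  from this[rule_format, OF assms(2-5)] assms(6-8) show ?thesis by simp
qed

lemma pao_witness_directed:
  assumes "pao_witness V E \<omega> \<Sigma> \<Omega>"
    and "\<sigma> \<in> \<Sigma>" "\<rho> \<in> \<Sigma>" "\<sigma> \<noteq> \<rho>" "u \<in> \<sigma>" "v \<in> \<rho>" "{u, v} \<in> E"
  shows "\<Omega> {\<sigma>, \<rho>} = Directed \<sigma> \<rho> \<or> \<Omega> {\<rho>, \<sigma>} = Directed \<rho> \<sigma>"
proof -
  have A: "acyclic_orientation (partition_graph_edges E \<Sigma>) \<Omega>"
    using assms(1) unfolding pao_witness_def by (elim conjE)
  have ed: "{\<sigma>, \<rho>} \<in> partition_graph_edges E \<Sigma>"
    unfolding partition_graph_edges_def using assms(2-7) by blast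
  have "\<Omega> {\<sigma>, \<rho>} \<in> insert (Undirected {\<sigma>, \<rho>}) {Directed u v | u v. {\<sigma>, \<rho>} = {u, v}}"
    using A ed unfolding acyclic_orientation_def orientations_def by (auto dest: PiE_mem)
  moreover have "\<Omega> {\<sigma>, \<rho>} \<noteq> Undirected {\<sigma>, \<rho>}"
    using A ed unfolding acyclic_orientation_def by simp
  ultimately show ?thesis
    unfolding insert_commute[of \<rho> \<sigma> "{}"] by (auto simp: doubleton_eq_iff)
qed

lemma pao_witness_partition:
  assumes G: "simple_graph V E" and w: "pao_witness V E \<omega> \<Sigma> \<Omega>"
  shows "\<Sigma> = (\<lambda>u. {(a, b). {a, b} \<in> E \<and> \<omega> {a, b} = Undirected {a, b}}\<^sup>* `` {u}) ` V"
proof -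
  define R where "R = {(a, b). {a, b} \<in> E \<and> \<omega> {a, b} = Undirected {a, b}}"
  have P: "partition_on V \<Sigma>" and C: "\<And>\<sigma>. \<sigma> \<in> \<Sigma> \<Longrightarrow> connected_graph \<sigma> (induced_edges E \<sigma>)"
    and U: "\<And>\<sigma> e. \<sigma> \<in> \<Sigma> \<Longrightarrow> e \<in> E \<Longrightarrow> e \<subseteq> \<sigma> \<Longrightarrow> \<omega> e = Undirected e"
    using w unfolding pao_witness_def connected_partition_def by simp_all
  have step: "b \<in> \<sigma>" if s: "\<sigma> \<in> \<Sigma>" "a \<in> \<sigma>" "(a, b) \<in> R" for a b \<sigma>
  proof (rule ccontr)
    assume nb: "b \<notin> \<sigma>"
    have e: "{a, b} \<in> E" and un: "\<omega> {a, b} = Undirected {a, b}" using s(3) by (auto simp: R_def)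
    have "b \<in> V" using e G by (auto simp: simple_graph_def)
    then obtain \<rho> where r: "\<rho> \<in> \<Sigma>" "b \<in> \<rho>" using P by (auto simp: partition_on_def)
    have ne: "\<sigma> \<noteq> \<rho>" using nb r by auto
    from pao_witness_directed[OF w s(1) r(1) ne s(2) r(2) e]
    show False
    proof
      assume "\<Omega> {\<sigma>, \<rho>} = Directed \<sigma> \<rho>"
      from pao_witness_arc[OF w s(1) r(1) s(2) r(2) ne e this] un show False by simp
    next
      assume o: "\<Omega> {\<rho>, \<sigma>} = Directed \<rho> \<sigma>"
      have "{b, a} \<in> E" using e by (simp add: insert_commute)
      from pao_witness_arc[OF w r(1) s(1) r(2) s(2) ne[symmetric] this o] un show False
        by (simp add: insert_commute)
    qed
  qed
  have eq: "R\<^sup>* `` {u} = \<sigma>" if s: "\<sigma> \<in> \<Sigma>" "u \<in> \<sigma>" for u \<sigma>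
  proof
    show "R\<^sup>* `` {u} \<subseteq> \<sigma>"
    proof
      fix v assume "v \<in> R\<^sup>* `` {u}"
      then have "(u, v) \<in> R\<^sup>*" by simp
      then show "v \<in> \<sigma>" by induction (use s step in auto)
    qed
    have "{(a, b). {a, b} \<in> induced_edges E \<sigma>} \<subseteq> R"
      using U[OF s(1)] by (auto simp: R_def induced_edges_def)
    then show "\<sigma> \<subseteq> R\<^sup>* `` {u}"
      using C[OF s(1)] s(2) rtrancl_mono unfolding connected_graph_def by blast
  qed
  have "\<Sigma> = (\<lambda>u. R\<^sup>* `` {u}) ` V"
  proof (intro equalityI subsetI)
    fix \<sigma> assume s: "\<sigma> \<in> \<Sigma>"
    then obtain u where "u \<in> \<sigma>" using P by (metis all_not_in_conv partition_on_def)
    moreover from this s P have "u \<in> V" by (auto simp: partition_on_def)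
    ultimately show "\<sigma> \<in> (\<lambda>u. R\<^sup>* `` {u}) ` V" using eq[OF s] by blast
  next
    fix \<sigma> assume "\<sigma> \<in> (\<lambda>u. R\<^sup>* `` {u}) ` V"
    then obtain u where u: "u \<in> V" "\<sigma> = R\<^sup>* `` {u}" by blast
    then obtain \<rho> where "\<rho> \<in> \<Sigma>" "u \<in> \<rho>" using P by (auto simp: partition_on_def)
    then show "\<sigma> \<in> \<Sigma>" using eq u by blast
  qed
  then show ?thesis unfolding R_def .
qed

lemma pao_witness_unique:
  assumes G: "simple_graph V E"
    and w: "pao_witness V E \<omega> \<Sigma> \<Omega>" and w': "pao_witness V E \<omega> \<Sigma>' \<Omega>'"
  shows "\<Sigma> = \<Sigma>'" and "\<Omega> = \<Omega>'"
proof -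
  show S: "\<Sigma> = \<Sigma>'"
    by (rule trans[OF pao_witness_partition[OF G w] pao_witness_partition[OF G w', symmetric]])
  have dir: "\<Omega>2 {\<sigma>, \<rho>} = Directed \<sigma> \<rho>"
    if w1: "pao_witness V E \<omega> \<Sigma> \<Omega>1" and w2: "pao_witness V E \<omega> \<Sigma> \<Omega>2"
      and m: "\<sigma> \<in> \<Sigma>" "\<rho> \<in> \<Sigma>" "\<sigma> \<noteq> \<rho>" "u \<in> \<sigma>" "v \<in> \<rho>" "{u, v} \<in> E"
      and o1: "\<Omega>1 {\<sigma>, \<rho>} = Directed \<sigma> \<rho>"
    for \<Omega>1 \<Omega>2 \<sigma> \<rho> u v
  proof (rule ccontr)
    assume n: "\<Omega>2 {\<sigma>, \<rho>} \<noteq> Directed \<sigma> \<rho>"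
    have o2: "\<Omega>2 {\<rho>, \<sigma>} = Directed \<rho> \<sigma>"
      using pao_witness_directed[OF w2 m] n by simp
    have "\<omega> {u, v} = Directed u v"
      using pao_witness_arc[OF w1 m(1,2,4,5,3,6) o1] .
    moreover have "{v, u} \<in> E" using m by (simp add: insert_commute)
    then have "\<omega> {v, u} = Directed v u"
      using pao_witness_arc[OF w2 m(2,1,5,4) m(3)[symmetric] _ o2] by simp
    ultimately have "Directed u v = Directed v u"
      unfolding insert_commute[of v u "{}"] by (rule trans[OF sym])
    then have "u = v" unfolding edge_orient.inject(2) by (rule conjunct1)
    then show False using m G by (auto simp: simple_graph_def)
  qed
  have W': "pao_witness V E \<omega> \<Sigma> \<Omega>'" using w' S by simp
  show "\<Omega> = \<Omega>'"
  proof (rule PiE_ext)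
    show "\<Omega> \<in> (\<Pi>\<^sub>E e\<in>partition_graph_edges E \<Sigma>. insert (Undirected e) {Directed u v | u v. e = {u, v}})"
      using w unfolding pao_witness_def acyclic_orientation_def orientations_def by (elim conjE)
    show "\<Omega>' \<in> (\<Pi>\<^sub>E e\<in>partition_graph_edges E \<Sigma>. insert (Undirected e) {Directed u v | u v. e = {u, v}})"
      using W' unfolding pao_witness_def acyclic_orientation_def orientations_def by (elim conjE)
    fix e assume e: "e \<in> partition_graph_edges E \<Sigma>"
    then obtain \<sigma> \<rho> u v where m: "e = {\<sigma>, \<rho>}" "\<sigma> \<in> \<Sigma>" "\<rho> \<in> \<Sigma>" "\<sigma> \<noteq> \<rho>" "u \<in> \<sigma>" "v \<in> \<rho>" "{u, v} \<in> E"
      unfolding partition_graph_edges_def by blast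
    from pao_witness_directed[OF w m(2-7)]
    consider "\<Omega> {\<sigma>, \<rho>} = Directed \<sigma> \<rho>" | "\<Omega> {\<rho>, \<sigma>} = Directed \<rho> \<sigma>" by blast
    then show "\<Omega> e = \<Omega>' e"
    proof cases
      case 1
      then show ?thesis using dir[OF w W' m(2-7)] m(1) by simp
    next
      case 2
      have "{v, u} \<in> E" using m by (simp add: insert_commute)
      have "\<Omega>' {\<rho>, \<sigma>} = Directed \<rho> \<sigma>"
        by (rule dir[OF w W' m(3) m(2) m(4)[symmetric] m(6) m(5) \<open>{v, u} \<in> E\<close> 2])
      then show ?thesis using 2 unfolding m(1) insert_commute[of \<sigma> \<rho> "{}"] by simp
    qed
  qed
qed

definition pao_partition ::
  "'a set \<Rightarrow> 'a set set \<Rightarrow> ('a set \<Rightarrow> 'a edge_orient) \<Rightarrow> 'a set set" where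
  "pao_partition V E \<omega> = (THE \<Sigma>. \<exists>\<Omega>. pao_witness V E \<omega> \<Sigma> \<Omega>)"

definition pao_quotient ::
  "'a set \<Rightarrow> 'a set set \<Rightarrow> ('a set \<Rightarrow> 'a edge_orient) \<Rightarrow> 'a set set \<Rightarrow> 'a set edge_orient" where
  "pao_quotient V E \<omega> = (THE \<Omega>. pao_witness V E \<omega> (pao_partition V E \<omega>) \<Omega>)"

lemma pao_witness_eqs:
  assumes "simple_graph V E" and "pao_witness V E \<omega> \<Sigma> \<Omega>"
  shows "pao_partition V E \<omega> = \<Sigma>" and "pao_quotient V E \<omega> = \<Omega>"
proof -
  show *: "pao_partition V E \<omega> = \<Sigma>"
    unfolding pao_partition_def
    by (rule the_equality) (use assms pao_witness_unique(1)[OF assms(1)] in blast)+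
  show "pao_quotient V E \<omega> = \<Omega>"
    unfolding pao_quotient_def *
    by (rule the_equality) (use assms pao_witness_unique(2)[OF assms(1)] in blast)+
qed

definition pao_dim :: "'a set \<Rightarrow> 'a set set \<Rightarrow> ('a set \<Rightarrow> 'a edge_orient) \<Rightarrow> int" where
  "pao_dim V E \<omega> = int (card V) - int (card (pao_partition V E \<omega>))"

text \<open>The pair \<open>(\<rho>, \<sigma>)\<close> lies in the reflexive transitive closure of the arcs iff \<open>\<rho> \<le> \<sigma>\<close> in the
  partial order induced by the acyclic orientation.\<close>

definition order_ideals :: "'a set \<Rightarrow> ('a \<times> 'a) set \<Rightarrow> 'a set set" where
  "order_ideals S r = {I. I \<subseteq> S \<and> (\<forall>b\<in>I. \<forall>a\<in>S. (a, b) \<in> r\<^sup>* \<longrightarrow> a \<in> I)}"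

definition pao_J :: "'a set \<Rightarrow> 'a set set \<Rightarrow> ('a set \<Rightarrow> 'a edge_orient) \<Rightarrow> 'a set set" where
  "pao_J V E \<omega> =
     {\<Union>I | I. I \<in> order_ideals (pao_partition V E \<omega>)
        (arcs (partition_graph_edges E (pao_partition V E \<omega>)) (pao_quotient V E \<omega>))}"

definition pao_le ::
  "'a set \<Rightarrow> 'a set set \<Rightarrow> ('a set \<Rightarrow> 'a edge_orient) \<Rightarrow> ('a set \<Rightarrow> 'a edge_orient) \<Rightarrow> bool" where
  "pao_le V E \<omega>1 \<omega>2 \<longleftrightarrow> pao_J V E \<omega>2 \<subseteq> pao_J V E \<omega>1"

definition graph_polytope :: "'n::finite set set \<Rightarrow> (real ^ 'n) set" where
  "graph_polytope E =
     {x. (\<Sum>i\<in>UNIV. x $ i) = real (CARD('n) + card E) \<and>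
         (\<forall>\<sigma>. (\<Sum>i\<in>\<sigma>. x $ i) \<ge> real (card \<sigma> + card (induced_edges E \<sigma>)))}"

definition nonempty_faces :: "'v::euclidean_space set \<Rightarrow> 'v set set" where
  "nonempty_faces P = {F. F face_of P \<and> F \<noteq> {}}"

end

theory Submission
  imports Defs
begin

text \<open>A real function \<open>a\<close> on the vertices orients every edge towards its larger value and leaves edges
  with equal values undirected. The orientations obtained in this way are exactly the partial
  acyclic orientations, and \<open>J\<close> of such an orientation consists of the vertex sets \<open>\<sigma>\<close> that contain
  with an end \<open>v\<close> of an edge \<open>{u, v}\<close> also \<open>u\<close> whenever \<open>a u \<le> a v\<close>.
  On the other side, \<open>a\<close> is a linear functional and exposes a face of the polytope. On that face lies
  the point obtained by letting every edge give its unit weight to its upper end (or half to both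
  ends), whose tight sets are exactly the members of \<open>J\<close>. Abel summation shows that the face
  is cut out by the tightness of these sets, hence inclusion of faces is reverse inclusion of \<open>J\<close>.
  Perturbing \<open>a\<close> shows that a functional is constant on the face iff it is constant on the
  blocks, which gives the dimension.\<close>

section \<open>Orientations induced by a real function on the vertices\<close>

text \<open>The strict inequality leaves at most one ordered pair for \<open>THE\<close>;
  restriction to \<open>E\<close> makes the function extensional, as \<open>orientations E\<close>
  requires.\<close>

definition level_orientation :: "'a set set \<Rightarrow> ('a \<Rightarrow> real) \<Rightarrow> 'a set \<Rightarrow> 'a edge_orient" where
  "level_orientation E a = (\<lambda>e\<in>E. if \<exists>u v. e = {u, v} \<and> a u < a v
     then (THE \<omega>. \<exists>u v. \<omega> = Directed u v \<and> e = {u, v} \<and> a u < a v) else Undirected e)"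

definition level_closed :: "'a set set \<Rightarrow> ('a \<Rightarrow> real) \<Rightarrow> 'a set set" where
  "level_closed E a = {\<sigma>. \<forall>u v. {u, v} \<in> E \<and> v \<in> \<sigma> \<and> a u \<le> a v \<longrightarrow> u \<in> \<sigma>}"

lemma level_orientation_directed:
  assumes "{u, v} \<in> E" "a u < a v"
  shows "level_orientation E a {u, v} = Directed u v"
proof -
  have "(THE \<omega>. \<exists>p q. \<omega> = Directed p q \<and> {u, v} = {p, q} \<and> a p < a q) = Directed u v"
    by (rule the_equality) (use assms in \<open>auto simp: doubleton_eq_iff\<close>)
  then show ?thesis using assms by (auto simp: level_orientation_def)
qed

lemma level_orientation_undirected:
  assumes "{u, v} \<in> E" "a u = a v"
  shows "level_orientation E a {u, v} = Undirected {u, v}"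
proof -
  have "\<not> (\<exists>p q. {u, v} = {p, q} \<and> a p < a q)"
    using assms by (auto simp: doubleton_eq_iff)
  then show ?thesis using assms(1) unfolding level_orientation_def restrict_apply
    by (simp only: if_False if_True)
qed

lemma level_orientation_cases:
  assumes "{u, v} \<in> E"
  obtains "a u < a v" "level_orientation E a {u, v} = Directed u v"
  | "a v < a u" "level_orientation E a {u, v} = Directed v u"
  | "a u = a v" "level_orientation E a {u, v} = Undirected {u, v}"
  using assms level_orientation_directed[of u v E a] level_orientation_directed[of v u E a]
    level_orientation_undirected[of u v E a]
  by (metis insert_commute linorder_less_linear)

lemma level_orientation_eq_Directed_iff:
  assumes "{u, v} \<in> E"
  shows "level_orientation E a {u, v} = Directed u v \<longleftrightarrow> a u < a v"
proof
  assume o: "level_orientation E a {u, v} = Directed u v"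
  show "a u < a v"
  proof (rule level_orientation_cases[OF assms, of a])
    assume "a v < a u" "level_orientation E a {u, v} = Directed v u"
    with o show ?thesis by (metis edge_orient.inject(2))
  qed (use o in auto)
qed (use assms level_orientation_directed in metis)

lemma level_orientation_mem:
  assumes "\<And>e. e \<in> E \<Longrightarrow> card e = 2"
  shows "level_orientation E a \<in> orientations E"
  unfolding orientations_def
proof (rule PiE_I)
  fix e assume e: "e \<in> E"
  then obtain u v where uv: "e = {u, v}" using assms by (meson card_2_iff)
  show "level_orientation E a e \<in> insert (Undirected e) {Directed u v |u v. e = {u, v}}"
    by (rule level_orientation_cases[OF e[unfolded uv], of a]) (use uv in auto)
qed (simp add: level_orientation_def)

lemma orientation_cong:
  assumes "\<omega> \<in> orientations E" "\<omega>' \<in> orientations E" "\<And>e. e \<in> E \<Longrightarrow> card e = 2"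
    and "\<And>u v. {u, v} \<in> E \<Longrightarrow> \<omega> {u, v} = \<omega>' {u, v}"
  shows "\<omega> = \<omega>'"
  by (rule PiE_ext[OF assms(1,2)[unfolded orientations_def]]) (metis assms(3,4) card_2_iff)

lemma level_closed_atMost: "{u. a u \<le> t} \<in> level_closed E a"
  by (auto simp: level_closed_def)

text \<open>The sublevel set of \<open>b\<close> at height \<open>b v\<close> serves as test set: it
  is in \<open>level_closed E b\<close>, and its membership in \<open>level_closed E a\<close>
  forces \<open>b u \<le> b v\<close>.\<close>

lemma level_closed_subset_iff:
  "level_closed E b \<subseteq> level_closed E a \<longleftrightarrow> (\<forall>u v. {u, v} \<in> E \<and> a u \<le> a v \<longrightarrow> b u \<le> b v)"
proof
  assume s: "level_closed E b \<subseteq> level_closed E a"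
  show "\<forall>u v. {u, v} \<in> E \<and> a u \<le> a v \<longrightarrow> b u \<le> b v"
  proof (intro allI impI)
    fix u v assume uv: "{u, v} \<in> E \<and> a u \<le> a v"
    have "{w. b w \<le> b v} \<in> level_closed E a" using s level_closed_atMost by blast
    then show "b u \<le> b v" using uv unfolding level_closed_def by blast
  qed
qed (unfold level_closed_def, blast)

text \<open>Each side records how the values at the two ends of every edge compare; the absence of
  loops keeps the two directions of an edge apart.\<close>

lemma level_closed_eq_iff:
  assumes "\<And>e. e \<in> E \<Longrightarrow> card e = 2"
  shows "level_closed E a = level_closed E b \<longleftrightarrow> level_orientation E a = level_orientation E b"
proof
  assume "level_closed E a = level_closed E b"
  then have *: "a u \<le> a v \<longleftrightarrow> b u \<le> b v" if "{u, v} \<in> E" for u v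
    using level_closed_subset_iff[of E a b] level_closed_subset_iff[of E b a] that by blast
  show "level_orientation E a = level_orientation E b"
  proof (rule orientation_cong[OF level_orientation_mem level_orientation_mem])
    fix u v assume e: "{u, v} \<in> E"
    then have e': "{v, u} \<in> E" by (simp add: insert_commute)
    show "level_orientation E a {u, v} = level_orientation E b {u, v}"
      by (rule level_orientation_cases[OF e, of a]; rule level_orientation_cases[OF e, of b])
        (use *[OF e] *[OF e'] in auto)
  qed (use assms in auto)
next
  assume eq: "level_orientation E a = level_orientation E b"
  have *: "a u \<le> a v \<longleftrightarrow> b u \<le> b v" if e: "{u, v} \<in> E" for u v
  proof -
    have "u \<noteq> v" using assms[OF e] by auto
    then show ?thesis
      by (rule_tac level_orientation_cases[OF e, of a]; rule_tac level_orientation_cases[OF e, of b])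
        (use eq in auto)
  qed
  then show "level_closed E a = level_closed E b"
    unfolding level_closed_def by blast
qed

section \<open>Partial acyclic orientations\<close>

text \<open>Rephrases \<open>pao_J\<close> through \<open>\<omega>\<close> alone, without definite
  descriptions: closure along undirected edges yields unions of blocks, closure along directed edges
  yields ideals.\<close>

lemma pao_J_eq:
  assumes G: "simple_graph V E" and w: "pao_witness V E \<omega> \<Sigma> \<Omega>"
  shows "pao_J V E \<omega> = {\<sigma>. \<sigma> \<subseteq> V \<and> (\<forall>u v. {u, v} \<in> E \<and> v \<in> \<sigma> \<and>
     (\<omega> {u, v} = Directed u v \<or> \<omega> {u, v} = Undirected {u, v}) \<longrightarrow> u \<in> \<sigma>)}"
proof -
  define r where "r = arcs (partition_graph_edges E \<Sigma>) \<Omega>"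
  have J: "pao_J V E \<omega> = {\<Union>I |I. I \<in> order_ideals \<Sigma> r}"
    unfolding pao_J_def r_def pao_witness_eqs[OF assms] ..
  have P: "partition_on V \<Sigma>" and C: "\<And>\<sigma>. \<sigma> \<in> \<Sigma> \<Longrightarrow> connected_graph \<sigma> (induced_edges E \<sigma>)"
    and U: "\<And>\<sigma> e. \<sigma> \<in> \<Sigma> \<Longrightarrow> e \<in> E \<Longrightarrow> e \<subseteq> \<sigma> \<Longrightarrow> \<omega> e = Undirected e"
    using w unfolding pao_witness_def connected_partition_def by simp_all
  have V: "u \<in> V" "v \<in> V" "u \<noteq> v" if "{u, v} \<in> E" for u v
    using that G by (auto simp: simple_graph_def)
  \<comment> \<open>A block is connected by edges that \<open>\<omega>\<close> leaves undirected, so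
    a set closed along such edges swallows every block it meets.\<close>
  have block: "\<beta> \<subseteq> \<sigma>"
    if \<sigma>: "\<And>u v. {u, v} \<in> E \<Longrightarrow> v \<in> \<sigma> \<Longrightarrow> \<omega> {u, v} = Undirected {u, v} \<Longrightarrow> u \<in> \<sigma>"
      and \<beta>: "\<beta> \<in> \<Sigma>" "v \<in> \<beta>" "v \<in> \<sigma>" for \<beta> \<sigma> v
  proof
    fix u assume "u \<in> \<beta>"
    then have "(v, u) \<in> {(p, q). {p, q} \<in> induced_edges E \<beta>}\<^sup>*"
      using C[OF \<beta>(1)] \<beta>(2) by (auto simp: connected_graph_def)
    then show "u \<in> \<sigma>"
    proof induction
      case (step y z)
      then have "{z, y} \<in> E" "{z, y} \<subseteq> \<beta>" by (auto simp: induced_edges_def insert_commute)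
      then show ?case using \<sigma>[of z y] U[OF \<beta>(1)] step.IH by blast
    qed (fact \<beta>(3))
  qed
  show ?thesis
  proof (intro equalityI subsetI)
    fix \<sigma> assume "\<sigma> \<in> pao_J V E \<omega>"
    then obtain I where I: "I \<in> order_ideals \<Sigma> r" "\<sigma> = \<Union>I" unfolding J by blast
    then have "I \<subseteq> \<Sigma>" by (auto simp: order_ideals_def)
    have "u \<in> \<sigma>" if e: "{u, v} \<in> E" and v: "v \<in> \<sigma>"
      and o: "\<omega> {u, v} = Directed u v \<or> \<omega> {u, v} = Undirected {u, v}" for u v
    proof -
      obtain \<beta> where \<beta>: "\<beta> \<in> I" "v \<in> \<beta>" using v I by blast
      then have \<beta>S: "\<beta> \<in> \<Sigma>" using \<open>I \<subseteq> \<Sigma>\<close> by blast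
      obtain \<gamma> where \<gamma>: "\<gamma> \<in> \<Sigma>" "u \<in> \<gamma>" using V[OF e] P by (auto simp: partition_on_def)
      show ?thesis
      proof (cases "\<gamma> = \<beta>")
        case True
        then show ?thesis using \<beta> \<gamma> I by blast
      next
        case False
        have e': "{v, u} \<in> E" using e by (simp add: insert_commute)
        have "\<Omega> {\<gamma>, \<beta>} = Directed \<gamma> \<beta>"
        \<comment> \<open>The opposite arc would make \<open>\<omega> {u, v}\<close> equal to
          \<open>Directed v u\<close>, which \<open>o\<close> excludes because
          \<open>u \<noteq> v\<close>.\<close>
        proof (rule ccontr)
          assume "\<Omega> {\<gamma>, \<beta>} \<noteq> Directed \<gamma> \<beta>"
          then have "\<Omega> {\<beta>, \<gamma>} = Directed \<beta> \<gamma>"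
            using pao_witness_directed[OF w \<gamma>(1) \<beta>S False \<gamma>(2) \<beta>(2) e] by blast
          from pao_witness_arc[OF w \<beta>S \<gamma>(1) \<beta>(2) \<gamma>(2) False[symmetric] e' this]
          show False using o V(3)[OF e] by (simp add: insert_commute)
        qed
        moreover have "{\<gamma>, \<beta>} \<in> partition_graph_edges E \<Sigma>"
          unfolding partition_graph_edges_def using \<gamma> \<beta> \<beta>S False e by blast
        ultimately have "(\<gamma>, \<beta>) \<in> r" by (simp add: r_def arcs_def)
        then have "\<gamma> \<in> I" using I(1) \<beta>(1) \<gamma>(1) by (auto simp: order_ideals_def)
        then show ?thesis using I \<gamma> by blast
      qed
    qed
    moreover have "\<sigma> \<subseteq> V" using I(2) \<open>I \<subseteq> \<Sigma>\<close> P by (auto simp: partition_on_def)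
    ultimately show "\<sigma> \<in> {\<sigma>. \<sigma> \<subseteq> V \<and> (\<forall>u v. {u, v} \<in> E \<and> v \<in> \<sigma> \<and>
       (\<omega> {u, v} = Directed u v \<or> \<omega> {u, v} = Undirected {u, v}) \<longrightarrow> u \<in> \<sigma>)}" by blast
  next
    fix \<sigma> assume s: "\<sigma> \<in> {\<sigma>. \<sigma> \<subseteq> V \<and> (\<forall>u v. {u, v} \<in> E \<and> v \<in> \<sigma> \<and>
       (\<omega> {u, v} = Directed u v \<or> \<omega> {u, v} = Undirected {u, v}) \<longrightarrow> u \<in> \<sigma>)}"
    then have cl: "u \<in> \<sigma>" if "{u, v} \<in> E" "v \<in> \<sigma>"
       "\<omega> {u, v} = Directed u v \<or> \<omega> {u, v} = Undirected {u, v}" for u v using that by blast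
    \<comment> \<open>The only possible ideal with union \<open>\<sigma>\<close>; by
      \<open>block\<close>, a block that meets \<open>\<sigma>\<close> lies inside it.\<close>
    define I where "I = {\<beta> \<in> \<Sigma>. \<beta> \<subseteq> \<sigma>}"
    have blk: "\<beta> \<in> I" if "\<beta> \<in> \<Sigma>" "v \<in> \<beta>" "v \<in> \<sigma>" for \<beta> v
      using block[of \<sigma> \<beta> v] cl that by (auto simp: I_def)
    have "\<Union>I = \<sigma>"
    proof
      show "\<sigma> \<subseteq> \<Union>I"
      proof
        fix v assume v: "v \<in> \<sigma>"
        then obtain \<beta> where "\<beta> \<in> \<Sigma>" "v \<in> \<beta>" using s P by (auto simp: partition_on_def)
        then show "v \<in> \<Union>I" using blk v by blast
      qed
    qed (auto simp: I_def)
    \<comment> \<open>Every arc of the quotient comes from an edge in \<open>E\<close> that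
      \<open>\<omega>\<close> directs the same way, and \<open>\<sigma>\<close> is closed along
      it.\<close>
    moreover have "\<alpha> \<in> I" if "(\<alpha>, \<beta>) \<in> r\<^sup>*" "\<beta> \<in> I" for \<alpha> \<beta>
      using that
    proof (induction rule: converse_rtrancl_induct)
      case (step \<gamma> \<delta>)
      then have \<delta>: "\<delta> \<in> \<Sigma>" "\<delta> \<subseteq> \<sigma>" by (auto simp: I_def)
      have gd: "{\<gamma>, \<delta>} \<in> partition_graph_edges E \<Sigma>" and O: "\<Omega> {\<gamma>, \<delta>} = Directed \<gamma> \<delta>"
        using step.hyps by (auto simp: r_def arcs_def)
      then obtain u v where uv: "\<gamma> \<in> \<Sigma>" "\<gamma> \<noteq> \<delta>" "u \<in> \<gamma>" "v \<in> \<delta>" "{u, v} \<in> E"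
        unfolding partition_graph_edges_def mem_Collect_eq doubleton_eq_iff
        by (metis insert_commute)
      have "\<omega> {u, v} = Directed u v"
        using pao_witness_arc[OF w uv(1) \<delta>(1) uv(3,4,2,5) O] .
      then have "u \<in> \<sigma>" using cl[of u v] uv \<delta> by blast
      then show ?case using blk uv by blast
    qed
    then have "I \<in> order_ideals \<Sigma> r" by (auto simp: order_ideals_def I_def)
    ultimately show "\<sigma> \<in> pao_J V E \<omega>" unfolding J by blast
  qed
qed

text \<open>The blocks are the connected components of the subgraph of edges with equal end values.
  As \<open>a\<close> is constant on each, it descends to the quotient, where it strictly increases
  along arcs and so rules out cycles.\<close>

lemma level_orientation_pao_witness:
  fixes a :: "'n::finite \<Rightarrow> real"
  assumes G: "simple_graph (UNIV :: 'n set) E"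
  defines "R \<equiv> {(p, q). {p, q} \<in> E \<and> a p = a q}"
  shows "\<exists>\<Omega>. pao_witness UNIV E (level_orientation E a) (UNIV // R\<^sup>*) \<Omega>"
proof -
  define \<Sigma> where "\<Sigma> = UNIV // R\<^sup>*"
  have "sym R" by (auto simp: sym_def R_def insert_commute)
  then have eqv: "equiv UNIV (R\<^sup>*)"
    by (simp add: equiv_def refl_rtrancl sym_rtrancl trans_rtrancl)
  then have P: "partition_on UNIV \<Sigma>" unfolding \<Sigma>_def by (rule partition_on_quotient)
  have lev: "a p = a q" if "(p, q) \<in> R\<^sup>*" for p q
    using that by induction (auto simp: R_def)
  have rel: "(p, q) \<in> R\<^sup>*" if "\<sigma> \<in> \<Sigma>" "p \<in> \<sigma>" "q \<in> \<sigma>" for \<sigma> p q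
    using that eqv unfolding \<Sigma>_def by (simp add: in_quotient_imp_in_rel)
  have cls: "q \<in> \<sigma>" if "\<sigma> \<in> \<Sigma>" "p \<in> \<sigma>" "(p, q) \<in> R\<^sup>*" for \<sigma> p q
    using that eqv unfolding \<Sigma>_def by (simp add: in_quotient_imp_closed)
  \<comment> \<open>The value of \<open>a\<close> at some representative; by \<open>lev\<close> and
    \<open>rel\<close> the choice does not matter.\<close>
  define A where "A \<sigma> = a (SOME p. p \<in> \<sigma>)" for \<sigma>
  have A: "A \<sigma> = a p" if "\<sigma> \<in> \<Sigma>" "p \<in> \<sigma>" for \<sigma> p
    unfolding A_def using that lev[OF rel[OF that(1)]] by (metis someI_ex)
  define \<Omega> where "\<Omega> = level_orientation (partition_graph_edges E \<Sigma>) A"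
  have conn: "connected_graph \<sigma> (induced_edges E \<sigma>)" if s: "\<sigma> \<in> \<Sigma>" for \<sigma>
    unfolding connected_graph_def
  proof (intro conjI ballI)
    show "\<sigma> \<noteq> {}" using P s by (auto simp: partition_on_def)
    fix u v assume uv: "u \<in> \<sigma>" "v \<in> \<sigma>"
    from rel[OF s uv] show "(u, v) \<in> {(p, q). {p, q} \<in> induced_edges E \<sigma>}\<^sup>*"
    proof induction
      case (step y z)
      have "y \<in> \<sigma>" "z \<in> \<sigma>"
        using cls[OF s uv(1)] step.hyps by (auto intro: rtrancl_into_rtrancl)
      then have "(y, z) \<in> {(p, q). {p, q} \<in> induced_edges E \<sigma>}"
        using step.hyps(2) by (auto simp: R_def induced_edges_def)
      then show ?case using step.IH by (rule rtrancl_into_rtrancl[rotated])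
    qed simp
  qed
  \<comment> \<open>Otherwise the edge \<open>{u, v}\<close> would belong to \<open>R\<close> and
    merge the two blocks.\<close>
  have neq: "A \<sigma> \<noteq> A \<rho>" if "\<sigma> \<in> \<Sigma>" "\<rho> \<in> \<Sigma>" "\<sigma> \<noteq> \<rho>" "u \<in> \<sigma>" "v \<in> \<rho>" "{u, v} \<in> E" for \<sigma> \<rho> u v
  proof
    assume "A \<sigma> = A \<rho>"
    then have "(u, v) \<in> R" using A that by (simp add: R_def)
    then have "v \<in> \<sigma>" using cls that by blast
    then show False using that P unfolding partition_on_def disjoint_def by blast
  qed
  have pge: "\<exists>\<sigma> \<rho>. e = {\<sigma>, \<rho>} \<and> A \<sigma> \<noteq> A \<rho>" if e: "e \<in> partition_graph_edges E \<Sigma>" for e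
  proof -
    obtain \<sigma> \<rho> u v where "e = {\<sigma>, \<rho>}" "\<sigma> \<in> \<Sigma>" "\<rho> \<in> \<Sigma>" "\<sigma> \<noteq> \<rho>" "u \<in> \<sigma>" "v \<in> \<rho>" "{u, v} \<in> E"
      using e unfolding partition_graph_edges_def by blast
    then show ?thesis using neq[of \<sigma> \<rho> u v] by (intro exI[of _ \<sigma>] exI[of _ \<rho>]) simp
  qed
  have ac: "acyclic_orientation (partition_graph_edges E \<Sigma>) \<Omega>"
    unfolding acyclic_orientation_def
  proof (intro conjI ballI)
    show "\<Omega> \<in> orientations (partition_graph_edges E \<Sigma>)"
      unfolding \<Omega>_def
    proof (rule level_orientation_mem)
      fix e assume "e \<in> partition_graph_edges E \<Sigma>"
      then obtain \<sigma> \<rho> where "e = {\<sigma>, \<rho>}" "A \<sigma> \<noteq> A \<rho>" using pge by blast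
      then show "card e = 2" by (auto simp: card_2_iff)
    qed
    show "\<Omega> e \<noteq> Undirected e" if e: "e \<in> partition_graph_edges E \<Sigma>" for e
    proof -
      obtain \<sigma> \<rho> where sr: "e = {\<sigma>, \<rho>}" "A \<sigma> \<noteq> A \<rho>" using pge[OF e] by blast
      show ?thesis
        by (rule level_orientation_cases[OF e[unfolded sr(1)], of A]) (use sr in \<open>auto simp: \<Omega>_def\<close>)
    qed
    have arc: "A \<sigma> < A \<rho>" if "(\<sigma>, \<rho>) \<in> arcs (partition_graph_edges E \<Sigma>) \<Omega>" for \<sigma> \<rho>
    proof -
      have e: "{\<sigma>, \<rho>} \<in> partition_graph_edges E \<Sigma>" and o: "\<Omega> {\<sigma>, \<rho>} = Directed \<sigma> \<rho>"
        using that by (auto simp: arcs_def)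
      show ?thesis using o unfolding \<Omega>_def level_orientation_eq_Directed_iff[OF e] .
    qed
    have "A \<sigma> < A \<rho>" if "(\<sigma>, \<rho>) \<in> (arcs (partition_graph_edges E \<Sigma>) \<Omega>)\<^sup>+" for \<sigma> \<rho>
      using that
    proof induction
      case (step \<rho> \<tau>)
      then show ?case using arc[of \<rho> \<tau>] by simp
    qed (rule arc)
    then show "acyclic (arcs (partition_graph_edges E \<Sigma>) \<Omega>)" unfolding acyclic_def by blast
  qed
  have "pao_witness UNIV E (level_orientation E a) \<Sigma> \<Omega>"
    unfolding pao_witness_def connected_partition_def
  proof (intro conjI ballI impI)
    show "level_orientation E a e = Undirected e" if "\<sigma> \<in> \<Sigma>" "e \<in> E" "e \<subseteq> \<sigma>" for \<sigma> e
    proof -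
      obtain u v where uv: "e = {u, v}" using G \<open>e \<in> E\<close> by (meson card_2_iff simple_graph_def)
      then have "a u = a v" using \<open>e \<subseteq> \<sigma>\<close> by (intro lev rel[OF \<open>\<sigma> \<in> \<Sigma>\<close>]) auto
      then show ?thesis using \<open>e \<in> E\<close> uv by (simp add: level_orientation_undirected)
    qed
    show "level_orientation E a {u, v} = Directed u v"
      if m: "\<sigma> \<in> \<Sigma>" "\<rho> \<in> \<Sigma>" "u \<in> \<sigma>" "v \<in> \<rho>" and o: "\<sigma> \<noteq> \<rho> \<and> {u, v} \<in> E \<and> \<Omega> {\<sigma>, \<rho>} = Directed \<sigma> \<rho>" for \<sigma> \<rho> u v
    proof -
      have e: "{\<sigma>, \<rho>} \<in> partition_graph_edges E \<Sigma>"
        unfolding partition_graph_edges_def using m o by blast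
      have "A \<sigma> < A \<rho>" using o unfolding \<Omega>_def level_orientation_eq_Directed_iff[OF e] by blast
      then show ?thesis using A m o level_orientation_directed by metis
    qed
  qed (fact P ac conn)+
  then show ?thesis unfolding \<Sigma>_def by blast
qed

lemma level_orientation_paos:
  fixes a :: "'n::finite \<Rightarrow> real"
  assumes "simple_graph (UNIV :: 'n set) E"
  shows "level_orientation E a \<in> paos UNIV E"
  using level_orientation_pao_witness[OF assms, of a] assms
  by (auto simp: paos_def simple_graph_def intro!: level_orientation_mem)

lemma pao_J_level_orientation:
  fixes a :: "'n::finite \<Rightarrow> real"
  assumes G: "simple_graph (UNIV :: 'n set) E"
  shows "pao_J UNIV E (level_orientation E a) = level_closed E a"
proof -
  have "level_orientation E a {u, v} = Directed u v \<or> level_orientation E a {u, v} = Undirected {u, v}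
      \<longleftrightarrow> a u \<le> a v" if e: "{u, v} \<in> E" for u v
  proof -
    have "u \<noteq> v" using e G by (auto simp: simple_graph_def)
    then show ?thesis by (rule_tac level_orientation_cases[OF e, of a]) auto
  qed
  then show ?thesis
    using pao_J_eq[OF G] level_orientation_pao_witness[OF G, of a]
    unfolding level_closed_def by (smt (verit) Collect_cong subset_UNIV)
qed

text \<open>A block is ranked by the number of its strict predecessors in the quotient. Acyclicity
  makes this rank increase strictly along arcs, and its pullback to the vertices induces
  \<open>\<omega>\<close>.\<close>

lemma pao_is_level_orientation:
  assumes G: "simple_graph (UNIV :: 'n::finite set) E" and "\<omega> \<in> paos UNIV E"
  shows "\<exists>a. \<omega> = level_orientation E a"
proof -
  obtain \<Sigma> \<Omega> where w: "pao_witness UNIV E \<omega> \<Sigma> \<Omega>" and om: "\<omega> \<in> orientations E"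
    using assms by (auto simp: paos_def)
  have P: "partition_on UNIV \<Sigma>"
    and U: "\<And>\<sigma> e. \<sigma> \<in> \<Sigma> \<Longrightarrow> e \<in> E \<Longrightarrow> e \<subseteq> \<sigma> \<Longrightarrow> \<omega> e = Undirected e"
    and ac: "acyclic (arcs (partition_graph_edges E \<Sigma>) \<Omega>)"
    using w unfolding pao_witness_def connected_partition_def acyclic_orientation_def by simp_all
  define r where "r = arcs (partition_graph_edges E \<Sigma>) \<Omega>"
  define A where "A \<sigma> = real (card {\<rho>. (\<rho>, \<sigma>) \<in> r\<^sup>+})" for \<sigma>
  have A: "A \<sigma> < A \<rho>" if "(\<sigma>, \<rho>) \<in> r" for \<sigma> \<rho>
  proof -
    have "{\<tau>. (\<tau>, \<sigma>) \<in> r\<^sup>+} \<subset> {\<tau>. (\<tau>, \<rho>) \<in> r\<^sup>+}"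
    proof
      show "{\<tau>. (\<tau>, \<sigma>) \<in> r\<^sup>+} \<subseteq> {\<tau>. (\<tau>, \<rho>) \<in> r\<^sup>+}"
        using that trancl_into_trancl[of _ \<sigma> r \<rho>] by blast
      have "\<sigma> \<in> {\<tau>. (\<tau>, \<rho>) \<in> r\<^sup>+}" "\<sigma> \<notin> {\<tau>. (\<tau>, \<sigma>) \<in> r\<^sup>+}"
        using that ac by (simp_all add: r_def acyclic_def r_into_trancl)
      then show "{\<tau>. (\<tau>, \<sigma>) \<in> r\<^sup>+} \<noteq> {\<tau>. (\<tau>, \<rho>) \<in> r\<^sup>+}" by blast
    qed
    then show ?thesis unfolding A_def by (simp add: psubset_card_mono)
  qed
  define B where "B u = (THE \<sigma>. \<sigma> \<in> \<Sigma> \<and> u \<in> \<sigma>)" for u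
  have "\<exists>!\<sigma>. \<sigma> \<in> \<Sigma> \<and> u \<in> \<sigma>" for u
  proof (rule ex_ex1I)
    show "\<exists>\<sigma>. \<sigma> \<in> \<Sigma> \<and> u \<in> \<sigma>" using P by (auto simp: partition_on_def)
    show "\<sigma> = \<rho>" if "\<sigma> \<in> \<Sigma> \<and> u \<in> \<sigma>" "\<rho> \<in> \<Sigma> \<and> u \<in> \<rho>" for \<sigma> \<rho>
      using that partition_onD2[OF P] disjointD by blast
  qed
  then have B: "B u \<in> \<Sigma>" "u \<in> B u" for u
    unfolding B_def by (metis (mono_tags, lifting) theI')+
  define a where "a u = A (B u)" for u
  have dir: "a u < a v \<and> \<omega> {u, v} = Directed u v"
    if "{u, v} \<in> E" "B u \<noteq> B v" "\<Omega> {B u, B v} = Directed (B u) (B v)" for u v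
  proof
    have "{B u, B v} \<in> partition_graph_edges E \<Sigma>"
      unfolding partition_graph_edges_def mem_Collect_eq
      by (intro exI[of _ "B u"] exI[of _ "B v"] conjI bexI[of _ u] bexI[of _ v]) (use B that in simp_all)
    then show "a u < a v" unfolding a_def using that by (intro A) (simp add: r_def arcs_def)
    show "\<omega> {u, v} = Directed u v" using pao_witness_arc[OF w B(1) B(1) B(2) B(2) that(2,1,3)] .
  qed
  have "\<omega> = level_orientation E a"
  proof (rule orientation_cong[OF om level_orientation_mem])
    fix u v assume e: "{u, v} \<in> E"
    then have e': "{v, u} \<in> E" by (simp add: insert_commute)
    show "\<omega> {u, v} = level_orientation E a {u, v}"
    proof (cases "B u = B v")
      case True
      then have "\<omega> {u, v} = Undirected {u, v}" using U[OF B(1)[of u] e] B(2)[of u] B(2)[of v] by auto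
      then show ?thesis using True e by (simp add: a_def level_orientation_undirected)
    next
      case False
      from pao_witness_directed[OF w B(1) B(1) False B(2) B(2) e]
      show ?thesis
      proof
        assume "\<Omega> {B u, B v} = Directed (B u) (B v)"
        with dir[OF e False] e show ?thesis by (simp add: level_orientation_directed)
      next
        assume "\<Omega> {B v, B u} = Directed (B v) (B u)"
        with dir[OF e' False[symmetric]] have "a v < a u" "\<omega> {v, u} = Directed v u" by auto
        with level_orientation_directed[OF e', of a] show ?thesis by (simp add: insert_commute)
      qed
    qed
  qed (use G in \<open>auto simp: simple_graph_def\<close>)
  then show ?thesis by blast
qed

section \<open>The faces of the polytope\<close>

text \<open>Abel summation along the level sets of \<open>a\<close>.\<close>

lemma sum_mult_ge_of_level_sums_nonpos:
  fixes a d :: "'a \<Rightarrow> real"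
  assumes "finite S" "\<And>t. (\<Sum>i\<in>{i \<in> S. a i \<le> t}. d i) \<le> 0" "\<And>i. i \<in> S \<Longrightarrow> a i \<le> M"
  shows "M * (\<Sum>i\<in>S. d i) \<le> (\<Sum>i\<in>S. a i * d i)"
  using assms
proof (induction S arbitrary: M rule: finite_psubset_induct)
  case (psubset S)
  show ?case
  proof (cases "S = {}")
    case False
    \<comment> \<open>The induction peels off the top level set \<open>T\<close>; the remainder
      \<open>S'\<close> is treated with the bound \<open>m\<close>.\<close>
    define m where "m = Max (a ` S)"
    have m: "a i \<le> m" if "i \<in> S" for i using that psubset.hyps by (simp add: m_def)
    obtain k where k: "k \<in> S" "a k = m"
      using Max_in[of "a ` S"] psubset.hyps False unfolding m_def by fastforce
    define S' where "S' = {i \<in> S. a i < m}"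
    define T where "T = {i \<in> S. a i = m}"
    have ST: "S = S' \<union> T" "S' \<inter> T = {}" "finite S'" "finite T"
      using m psubset.hyps by (force simp: S'_def T_def)+
    have IH: "m * (\<Sum>i\<in>S'. d i) \<le> (\<Sum>i\<in>S'. a i * d i)"
    proof (rule psubset.IH)
      show "S' \<subset> S" using k by (auto simp: S'_def)
      show "(\<Sum>i\<in>{i \<in> S'. a i \<le> t}. d i) \<le> 0" for t
      proof (cases "t < m")
        case True
        then have "{i \<in> S'. a i \<le> t} = {i \<in> S. a i \<le> t}" by (auto simp: S'_def)
        then show ?thesis using psubset.prems(1) by simp
      next
        case False
        show ?thesis
        proof (cases "S' = {}")
          case False
          \<comment> \<open>A threshold of at least \<open>m\<close> cuts out all of
            \<open>S'\<close>, which is also a sublevel set of \<open>S\<close>, namely at the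
            maximum \<open>m'\<close> over \<open>S'\<close>.\<close>
          define m' where "m' = Max (a ` S')"
          have m': "a i \<le> m'" if "i \<in> S'" for i using that ST by (simp add: m'_def)
          have "m' \<in> a ` S'" unfolding m'_def using ST False by (intro Max_in) auto
          then have "m' < m" by (auto simp: S'_def)
          then have "{i \<in> S'. a i \<le> t} = {i \<in> S. a i \<le> m'}"
            using m' \<open>\<not> t < m\<close> by (auto simp: S'_def)
          then show ?thesis using psubset.prems(1) by simp
        qed simp
      qed
    qed (auto simp: S'_def)
    have "(\<Sum>i\<in>S. d i) \<le> 0"
      using psubset.prems(1)[of m] m by (simp add: Collect_conj_eq Int_absorb2 subset_iff)
    moreover have "m \<le> M" using psubset.prems(2)[OF k(1)] k(2) by simp
    \<comment> \<open>The total is nonpositive, so lowering the factor from \<open>M\<close> to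
      \<open>m\<close> can only raise the product.\<close>
    ultimately have "M * (\<Sum>i\<in>S. d i) \<le> m * (\<Sum>i\<in>S. d i)" by (rule mult_right_mono_neg[rotated])
    also have "\<dots> = m * (\<Sum>i\<in>S'. d i) + m * (\<Sum>i\<in>T. d i)"
      unfolding ST(1) using ST by (simp add: sum.union_disjoint distrib_left)
    also have "m * (\<Sum>i\<in>T. d i) = (\<Sum>i\<in>T. a i * d i)"
      by (simp add: T_def sum_distrib_left)
    also have "m * (\<Sum>i\<in>S'. d i) + \<dots> \<le> (\<Sum>i\<in>S'. a i * d i) + (\<Sum>i\<in>T. a i * d i)"
      using IH by simp
    also have "\<dots> = (\<Sum>i\<in>S. a i * d i)"
      unfolding ST(1) using ST by (simp add: sum.union_disjoint)
    finally show ?thesis .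
  qed simp
qed

section \<open>The point obtained by splitting edge weights, and its optimality\<close>

text \<open>The part of the unit weight of the edge \<open>{u, v}\<close> that goes to the second
  argument \<open>v\<close>; always \<open>share a u v + share a v u = 1\<close>.\<close>

definition share :: "('a \<Rightarrow> real) \<Rightarrow> 'a \<Rightarrow> 'a \<Rightarrow> real" where
  "share a u v = (if a u < a v then 1 else if a u = a v then 1 / 2 else 0)"

text \<open>If no edge has equal end values, the coordinates are one plus the indegrees in the
  induced orientation.\<close>

definition face_center :: "'n::finite set set \<Rightarrow> real ^ 'n \<Rightarrow> real ^ 'n" where
  "face_center E a = (\<chi> v. 1 + (\<Sum>u | {u, v} \<in> E. share (($) a) u v))"

text \<open>Ordered pairs are grouped by their edge: each induced edge is met from both ends, and
  its two shares add up to 1.\<close>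

lemma sum_share_induced_edges:
  assumes G: "simple_graph (UNIV :: 'n::finite set) E"
  shows "(\<Sum>v\<in>\<sigma>. \<Sum>u | {u, v} \<in> E \<and> u \<in> \<sigma>. share a u v) = real (card (induced_edges E \<sigma>))"
proof -
  define S where "S = Sigma \<sigma> (\<lambda>v. {u. {u, v} \<in> E \<and> u \<in> \<sigma>})"
  have inner: "(\<Sum>x\<in>{x \<in> S. {snd x, fst x} = e}. share a (snd x) (fst x)) = 1"
    if e: "e \<in> induced_edges E \<sigma>" for e
  proof -
    have "card e = 2" using e G by (auto simp: induced_edges_def simple_graph_def)
    then obtain p q where pq: "e = {p, q}" "p \<noteq> q" by (meson card_2_iff)
    have "{x \<in> S. {snd x, fst x} = e} = {(p, q), (q, p)}"
      using e pq by (auto simp: S_def induced_edges_def doubleton_eq_iff insert_commute)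
    then show ?thesis using pq by (auto simp: share_def)
  qed
  have "(\<Sum>v\<in>\<sigma>. \<Sum>u | {u, v} \<in> E \<and> u \<in> \<sigma>. share a u v) = (\<Sum>x\<in>S. share a (snd x) (fst x))"
    unfolding S_def by (subst sum.Sigma) (auto simp: case_prod_beta)
  also have "\<dots> = (\<Sum>e\<in>induced_edges E \<sigma>. \<Sum>x\<in>{x \<in> S. {snd x, fst x} = e}. share a (snd x) (fst x))"
    by (rule sum.group[symmetric]) (auto simp: S_def induced_edges_def)
  also have "\<dots> = real (card (induced_edges E \<sigma>))" using inner by simp
  finally show ?thesis .
qed

text \<open>Neighbours inside \<open>\<sigma>\<close> account for the induced edges; the last sum is
  the slack of the inequality, the weight that enters \<open>\<sigma>\<close> through its
  boundary.\<close>

lemma sum_face_center: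
  assumes G: "simple_graph (UNIV :: 'n::finite set) E"
  shows "(\<Sum>i\<in>\<sigma>. face_center E a $ i) = real (card \<sigma> + card (induced_edges E \<sigma>)) +
    (\<Sum>v\<in>\<sigma>. \<Sum>u | {u, v} \<in> E \<and> u \<notin> \<sigma>. share (($) a) u v)"
proof -
  have "(\<Sum>u | {u, v} \<in> E. share (($) a) u v) = (\<Sum>u | {u, v} \<in> E \<and> u \<in> \<sigma>. share (($) a) u v)
      + (\<Sum>u | {u, v} \<in> E \<and> u \<notin> \<sigma>. share (($) a) u v)" for v
    by (subst sum.union_disjoint[symmetric]) (auto intro: sum.cong)
  then show ?thesis
    unfolding face_center_def
    by (simp add: sum.distrib sum_share_induced_edges[OF G])
qed

lemma sum_face_center_ge:
  assumes "simple_graph (UNIV :: 'n::finite set) E"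
  shows "real (card \<sigma> + card (induced_edges E \<sigma>)) \<le> (\<Sum>i\<in>\<sigma>. face_center E a $ i)"
  unfolding sum_face_center[OF assms] by (simp add: sum_nonneg share_def)

text \<open>The slack has nonnegative summands, so it vanishes iff every boundary edge gives all its
  weight to its outer end, meaning that \<open>a\<close> is larger there.\<close>

lemma sum_face_center_tight_iff:
  assumes "simple_graph (UNIV :: 'n::finite set) E"
  shows "(\<Sum>i\<in>\<sigma>. face_center E a $ i) = real (card \<sigma> + card (induced_edges E \<sigma>))
    \<longleftrightarrow> \<sigma> \<in> level_closed E (($) a)"
proof -
  have share0: "share (($) a) u v = 0 \<longleftrightarrow> a $ v < a $ u" for u v by (auto simp: share_def)
  have "(\<Sum>i\<in>\<sigma>. face_center E a $ i) = real (card \<sigma> + card (induced_edges E \<sigma>))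
    \<longleftrightarrow> (\<Sum>v\<in>\<sigma>. \<Sum>u | {u, v} \<in> E \<and> u \<notin> \<sigma>. share (($) a) u v) = 0"
    unfolding sum_face_center[OF assms] by simp
  also have "\<dots> \<longleftrightarrow> (\<forall>v\<in>\<sigma>. \<forall>u\<in>{u. {u, v} \<in> E \<and> u \<notin> \<sigma>}. share (($) a) u v = 0)"
    by (subst sum_nonneg_eq_0_iff; simp add: sum_nonneg share_def)
       (subst sum_nonneg_eq_0_iff; simp)
  also have "\<dots> \<longleftrightarrow> \<sigma> \<in> level_closed E (($) a)"
    unfolding share0 by (auto simp: level_closed_def simp flip: not_le)
  finally show ?thesis .
qed

lemma graph_polytope_sum_UNIV:
  fixes x :: "real ^ 'n::finite"
  assumes "x \<in> graph_polytope E"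
  shows "(\<Sum>i\<in>UNIV. x $ i) = real (CARD('n) + card E)"
  using assms by (simp add: graph_polytope_def)

lemma graph_polytope_sum_ge:
  assumes "x \<in> graph_polytope E"
  shows "real (card \<sigma> + card (induced_edges E \<sigma>)) \<le> (\<Sum>i\<in>\<sigma>. x $ i)"
  using assms by (simp add: graph_polytope_def)

lemma face_center_mem:
  assumes G: "simple_graph (UNIV :: 'n::finite set) E"
  shows "face_center E a \<in> graph_polytope E"
proof -
  \<comment> \<open>\<open>UNIV\<close> is trivially in \<open>level_closed\<close>, and its
    tightness is the defining equation of the polytope.\<close>
  have "(\<Sum>i\<in>UNIV. face_center E a $ i) = real (CARD('n) + card E)"
    using sum_face_center_tight_iff[OF G, of a UNIV] by (simp add: level_closed_def induced_edges_def)
  then show ?thesis using sum_face_center_ge[OF G] by (simp add: graph_polytope_def)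
qed

text \<open>An optimality criterion: for \<open>d = y - x\<close>, tightness of \<open>y\<close>
  makes all sublevel sums nonpositive. Abel summation then bounds the weighted sum of
  \<open>d\<close> below by a multiple of its total, which is zero.\<close>

lemma inner_le_if_level_tight:
  fixes x y :: "real ^ 'n::finite"
  assumes x: "x \<in> graph_polytope E" and y: "y \<in> graph_polytope E"
    and tight: "\<And>t. (\<Sum>i | b $ i \<le> t. y $ i)
      = real (card {i. b $ i \<le> t} + card (induced_edges E {i. b $ i \<le> t}))"
  shows "b \<bullet> x \<le> b \<bullet> y"
proof -
  define d where "d i = y $ i - x $ i" for i
  have "Max (range (($) b)) * (\<Sum>i\<in>UNIV. d i) \<le> (\<Sum>i\<in>UNIV. b $ i * d i)"
  proof (rule sum_mult_ge_of_level_sums_nonpos)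
    fix t
    have "(\<Sum>i | b $ i \<le> t. y $ i) \<le> (\<Sum>i | b $ i \<le> t. x $ i)"
      unfolding tight by (rule graph_polytope_sum_ge[OF x])
    then show "(\<Sum>i | i \<in> UNIV \<and> b $ i \<le> t. d i) \<le> 0" by (simp add: d_def sum_subtractf)
  qed auto
  moreover have "(\<Sum>i\<in>UNIV. d i) = 0"
    using graph_polytope_sum_UNIV[OF x] graph_polytope_sum_UNIV[OF y]
    by (simp add: d_def sum_subtractf)
  ultimately show ?thesis
    by (simp add: d_def inner_vec_def right_diff_distrib sum_subtractf)
qed

text \<open>Sublevel sets of \<open>b\<close> are in \<open>level_closed\<close> for
  \<open>b\<close>, hence tight at the center for \<open>a\<close>. Allowing \<open>b\<close> to
  differ from \<open>a\<close> covers perturbed functionals.\<close>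

lemma inner_le_face_center:
  fixes x :: "real ^ 'n::finite"
  assumes G: "simple_graph (UNIV :: 'n set) E" and x: "x \<in> graph_polytope E"
    and sub: "level_closed E (($) b) \<subseteq> level_closed E (($) a)"
  shows "b \<bullet> x \<le> b \<bullet> face_center E a"
proof (rule inner_le_if_level_tight[OF x face_center_mem[OF G]])
  fix t
  have "{i. b $ i \<le> t} \<in> level_closed E (($) a)" using sub level_closed_atMost by blast
  then show "(\<Sum>i | b $ i \<le> t. face_center E a $ i)
      = real (card {i. b $ i \<le> t} + card (induced_edges E {i. b $ i \<le> t}))"
    unfolding sum_face_center_tight_iff[OF G] .
qed

section \<open>Faces exposed by functionals, and their tight sets\<close>

text \<open>For a simple graph \<open>face_center E a\<close> maximises \<open>a\<close> on the
  polytope, so this is the face exposed by \<open>a\<close>.\<close>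

definition level_face :: "'n::finite set set \<Rightarrow> real ^ 'n \<Rightarrow> (real ^ 'n) set" where
  "level_face E a = {x \<in> graph_polytope E. a \<bullet> x = a \<bullet> face_center E a}"

lemma face_center_mem_level_face:
  assumes "simple_graph (UNIV :: 'n::finite set) E"
  shows "face_center E a \<in> level_face E a"
  using face_center_mem[OF assms] by (simp add: level_face_def)

text \<open>Only finitely many strict inequalities have to survive, and each holds for all small
  positive \<open>\<epsilon>\<close> by continuity.\<close>

lemma perturbation_preserves_less:
  fixes a w :: "real ^ 'n::finite"
  obtains \<epsilon> where "\<epsilon> > 0" "\<And>u v. a $ u < a $ v \<Longrightarrow> (a + \<epsilon> *\<^sub>R w) $ u < (a + \<epsilon> *\<^sub>R w) $ v"
proof -
  have "\<forall>\<^sub>F \<epsilon> in at_right 0. \<forall>u v. a $ u < a $ v \<longrightarrow> (a + \<epsilon> *\<^sub>R w) $ u < (a + \<epsilon> *\<^sub>R w) $ v"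
  proof (intro eventually_all_finite)
    fix u v
    show "\<forall>\<^sub>F \<epsilon> in at_right 0. a $ u < a $ v \<longrightarrow> (a + \<epsilon> *\<^sub>R w) $ u < (a + \<epsilon> *\<^sub>R w) $ v"
    proof (cases "a $ u < a $ v")
      case True
      have "((\<lambda>\<epsilon>. a $ v + \<epsilon> * w $ v - (a $ u + \<epsilon> * w $ u)) \<longlongrightarrow> a $ v + 0 * w $ v - (a $ u + 0 * w $ u)) (at_right 0)"
        by (intro tendsto_intros)
      then have "\<forall>\<^sub>F \<epsilon> in at_right 0. 0 < a $ v + \<epsilon> * w $ v - (a $ u + \<epsilon> * w $ u)"
        by (rule order_tendstoD(1)) (use True in simp)
      then show ?thesis by eventually_elim simp
    qed simp
  qed
  moreover have "\<forall>\<^sub>F \<epsilon>::real in at_right 0. 0 < \<epsilon>" by (rule eventually_at_right_less)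
  ultimately have "\<forall>\<^sub>F \<epsilon> in at_right 0. 0 < \<epsilon> \<and>
      (\<forall>u v. a $ u < a $ v \<longrightarrow> (a + \<epsilon> *\<^sub>R w) $ u < (a + \<epsilon> *\<^sub>R w) $ v)"
    by eventually_elim simp
  from eventually_happens[OF this] show ?thesis using that by auto
qed

text \<open>A functional constant on the blocks perturbs \<open>a\<close> without changing the orientation, so that
  the point \<open>face_center E a\<close> remains a maximiser.\<close>

lemma level_face_inner_eq:
  fixes a w :: "real ^ 'n::finite"
  assumes G: "simple_graph (UNIV :: 'n set) E" and x: "x \<in> level_face E a"
    and w: "\<And>u v. {u, v} \<in> E \<Longrightarrow> a $ u = a $ v \<Longrightarrow> w $ u = w $ v"
  shows "w \<bullet> x = w \<bullet> face_center E a"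
proof -
  have le: "w \<bullet> x \<le> w \<bullet> face_center E a"
    if w: "\<And>u v. {u, v} \<in> E \<Longrightarrow> a $ u = a $ v \<Longrightarrow> w $ u = w $ v" for w
  proof -
    obtain \<epsilon> where \<epsilon>: "\<epsilon> > 0" "\<And>u v. a $ u < a $ v \<Longrightarrow> (a + \<epsilon> *\<^sub>R w) $ u < (a + \<epsilon> *\<^sub>R w) $ v"
      using perturbation_preserves_less[of a w] by blast
    have "level_closed E (($) (a + \<epsilon> *\<^sub>R w)) \<subseteq> level_closed E (($) a)"
      unfolding level_closed_subset_iff
    proof (intro allI impI)
      fix u v assume "{u, v} \<in> E \<and> a $ u \<le> a $ v"
      then show "(a + \<epsilon> *\<^sub>R w) $ u \<le> (a + \<epsilon> *\<^sub>R w) $ v"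
        using \<epsilon>(2)[of u v] w[of u v] by (cases "a $ u = a $ v") auto
    qed
    from inner_le_face_center[OF G _ this, of x] x
    have "\<epsilon> * (w \<bullet> x) \<le> \<epsilon> * (w \<bullet> face_center E a)"
      by (simp add: level_face_def inner_add_left)
    then show ?thesis using \<epsilon>(1) by simp
  qed
  \<comment> \<open>The condition on \<open>w\<close> passes to \<open>- w\<close>, so the one-sided
    bound gives equality.\<close>
  show ?thesis using le[of w] le[of "- w"] w by fastforce
qed

definition indicator_vec :: "'n::finite set \<Rightarrow> real ^ 'n" where
  "indicator_vec \<sigma> = (\<chi> i. if i \<in> \<sigma> then 1 else 0)"

lemma inner_indicator_vec: "indicator_vec \<sigma> \<bullet> x = (\<Sum>i\<in>\<sigma>. x $ i)"
  by (simp add: indicator_vec_def inner_vec_def if_distrib[of "\<lambda>y. y * _"] sum.If_cases cong: if_cong)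

text \<open>The indicator of a closed set is constant along edges with equal end values, so its
  functional takes on the whole face the tight value it has at the center. Conversely, tightness at
  the sublevel sets of \<open>a\<close> already makes \<open>x\<close> a maximiser.\<close>

lemma level_face_eq:
  assumes G: "simple_graph (UNIV :: 'n::finite set) E"
  shows "level_face E a = {x \<in> graph_polytope E. \<forall>\<sigma>\<in>level_closed E (($) a).
    (\<Sum>i\<in>\<sigma>. x $ i) = real (card \<sigma> + card (induced_edges E \<sigma>))}"
proof (intro equalityI subsetI)
  fix x assume x: "x \<in> level_face E a"
  have "(\<Sum>i\<in>\<sigma>. x $ i) = real (card \<sigma> + card (induced_edges E \<sigma>))"
    if \<sigma>: "\<sigma> \<in> level_closed E (($) a)" for \<sigma>
  proof -
    have "indicator_vec \<sigma> \<bullet> x = indicator_vec \<sigma> \<bullet> face_center E a"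
    proof (rule level_face_inner_eq[OF G x])
      fix u v assume "{u, v} \<in> E" "a $ u = a $ v"
      moreover from this have "{v, u} \<in> E" by (simp add: insert_commute)
      ultimately have "u \<in> \<sigma> \<longleftrightarrow> v \<in> \<sigma>"
        using \<sigma> unfolding level_closed_def mem_Collect_eq by (metis order_refl)
      then show "indicator_vec \<sigma> $ u = indicator_vec \<sigma> $ v" by (simp add: indicator_vec_def)
    qed
    then show ?thesis
      using \<sigma> sum_face_center_tight_iff[OF G, of a \<sigma>] by (simp add: inner_indicator_vec)
  qed
  then show "x \<in> {x \<in> graph_polytope E. \<forall>\<sigma>\<in>level_closed E (($) a).
    (\<Sum>i\<in>\<sigma>. x $ i) = real (card \<sigma> + card (induced_edges E \<sigma>))}"
    using x by (auto simp: level_face_def)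
next
  fix x assume x: "x \<in> {x \<in> graph_polytope E. \<forall>\<sigma>\<in>level_closed E (($) a).
    (\<Sum>i\<in>\<sigma>. x $ i) = real (card \<sigma> + card (induced_edges E \<sigma>))}"
  then have xP: "x \<in> graph_polytope E" by simp
  have "a \<bullet> face_center E a \<le> a \<bullet> x"
  proof (rule inner_le_if_level_tight[OF face_center_mem[OF G] xP])
    show "(\<Sum>i | a $ i \<le> t. x $ i)
      = real (card {i. a $ i \<le> t} + card (induced_edges E {i. a $ i \<le> t}))" for t
      using x level_closed_atMost[of "($) a" t E] by simp
  qed
  then show "x \<in> level_face E a"
    using inner_le_face_center[OF G xP, of a a] xP by (simp add: level_face_def)
qed

text \<open>The center for \<open>a\<close> has no tight sets beyond
  \<open>level_closed E (($) a)\<close>, so this single point decides the inclusion.\<close>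

lemma level_closed_subset_if_center_mem:
  assumes G: "simple_graph (UNIV :: 'n::finite set) E"
    and "face_center E a \<in> level_face E b"
  shows "level_closed E (($) b) \<subseteq> level_closed E (($) a)"
proof
  fix \<sigma> assume "\<sigma> \<in> level_closed E (($) b)"
  then have "(\<Sum>i\<in>\<sigma>. face_center E a $ i) = real (card \<sigma> + card (induced_edges E \<sigma>))"
    using assms(2) unfolding level_face_eq[OF G] by blast
  then show "\<sigma> \<in> level_closed E (($) a)" by (simp only: sum_face_center_tight_iff[OF G])
qed

lemma level_face_subset_iff:
  assumes G: "simple_graph (UNIV :: 'n::finite set) E"
  shows "level_face E a \<subseteq> level_face E b \<longleftrightarrow> level_closed E (($) b) \<subseteq> level_closed E (($) a)"
proof
  assume "level_face E a \<subseteq> level_face E b"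
  then show "level_closed E (($) b) \<subseteq> level_closed E (($) a)"
    using face_center_mem_level_face[OF G] by (intro level_closed_subset_if_center_mem[OF G]) blast
next
  assume "level_closed E (($) b) \<subseteq> level_closed E (($) a)"
  then show "level_face E a \<subseteq> level_face E b" unfolding level_face_eq[OF G] by blast
qed

lemma graph_polytope_polyhedron: "polyhedron (graph_polytope E)"
proof -
  have eq: "graph_polytope E = {x. indicator_vec UNIV \<bullet> x = real (CARD('a) + card E)} \<inter>
    (\<Inter>\<sigma>. {x. indicator_vec \<sigma> \<bullet> x \<ge> real (card \<sigma> + card (induced_edges E \<sigma>))})"
    for E :: "'a::finite set set"
    by (auto simp: graph_polytope_def inner_indicator_vec)
  show ?thesis
    unfolding eq by (intro polyhedron_Int polyhedron_Inter polyhedron_hyperplane)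
      (auto simp only: polyhedron_halfspace_ge finite_imageI finite)
qed

lemma graph_polytope_polytope: "polytope (graph_polytope E)"
proof -
  have "bounded (graph_polytope E)" for E :: "'a::finite set set"
  proof (rule boundedI)
    fix x assume x: "x \<in> graph_polytope E"
    \<comment> \<open>With nonnegative coordinates the l1 norm is the coordinate sum, which is fixed
      on the polytope.\<close>
    have nn: "0 \<le> x $ i" for i
      using graph_polytope_sum_ge[OF x, of "{i}"] by simp
    have "norm x \<le> (\<Sum>i\<in>UNIV. \<bar>x $ i\<bar>)" by (rule norm_le_l1_cart)
    also have "\<dots> = real (CARD('a) + card E)" using graph_polytope_sum_UNIV[OF x] nn by simp
    finally show "norm x \<le> real (CARD('a) + card E)" .
  qed
  then show ?thesis by (simp add: polytope_eq_bounded_polyhedron graph_polytope_polyhedron)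
qed

text \<open>Faces of a polyhedron are exposed, and on a nonempty face the bound of the exposing
  functional is attained, so it equals the value at \<open>face_center\<close>.\<close>

lemma nonempty_faces_graph_polytope:
  assumes G: "simple_graph (UNIV :: 'n::finite set) E"
  shows "nonempty_faces (graph_polytope E) = range (level_face E)"
proof (intro equalityI subsetI)
  fix F assume "F \<in> nonempty_faces (graph_polytope E)"
  then have "F exposed_face_of graph_polytope E" and "F \<noteq> {}"
    by (simp_all add: nonempty_faces_def exposed_face_of_polyhedron graph_polytope_polyhedron)
  then obtain a b y where ab: "graph_polytope E \<subseteq> {x. a \<bullet> x \<le> b}" "F = graph_polytope E \<inter> {x. a \<bullet> x = b}"
    and y: "y \<in> F"
    unfolding exposed_face_of_def by blast
  have "a \<bullet> face_center E a \<le> b" using ab(1) face_center_mem[OF G] by blast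
  moreover have "b \<le> a \<bullet> face_center E a"
    using inner_le_face_center[OF G, of y a a] y ab(2) by simp
  ultimately show "F \<in> range (level_face E)" using ab(2) by (auto simp: level_face_def)
next
  fix F assume "F \<in> range (level_face E)"
  then obtain a where F: "F = level_face E a" by blast
  have "F = graph_polytope E \<inter> {x. a \<bullet> x = a \<bullet> face_center E a}"
    unfolding F level_face_def by blast
  moreover have "(graph_polytope E \<inter> {x. a \<bullet> x = a \<bullet> face_center E a}) face_of graph_polytope E"
    using inner_le_face_center[OF G, of _ a a]
    by (intro face_of_Int_supporting_hyperplane_le polyhedron_imp_convex graph_polytope_polyhedron) auto
  ultimately show "F \<in> nonempty_faces (graph_polytope E)"
    using face_center_mem_level_face[OF G, of a] F by (auto simp: nonempty_faces_def)
qed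

section \<open>Dimension\<close>

text \<open>The indicator vectors of the blocks form an orthogonal basis.\<close>

lemma dim_constant_on_blocks:
  assumes P: "partition_on (UNIV :: 'n::finite set) \<Sigma>"
  shows "dim {w :: real ^ 'n. \<forall>\<sigma>\<in>\<Sigma>. \<forall>u\<in>\<sigma>. \<forall>v\<in>\<sigma>. w $ u = w $ v} = card \<Sigma>"
proof -
  define W where "W = {w :: real ^ 'n. \<forall>\<sigma>\<in>\<Sigma>. \<forall>u\<in>\<sigma>. \<forall>v\<in>\<sigma>. w $ u = w $ v}"
  have disj: "\<sigma> = \<rho>" if "\<sigma> \<in> \<Sigma>" "\<rho> \<in> \<Sigma>" "i \<in> \<sigma>" "i \<in> \<rho>" for \<sigma> \<rho> i
    using disjointD[OF partition_onD2[OF P], of \<sigma> \<rho>] that by blast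
  have ne: "\<sigma> \<noteq> {}" if "\<sigma> \<in> \<Sigma>" for \<sigma> using that partition_onD3[OF P] by blast
  have inj: "inj_on indicator_vec \<Sigma>"
  proof (rule inj_onI)
    fix \<sigma> \<rho> :: "'n set" assume "indicator_vec \<sigma> = indicator_vec \<rho>"
    then have "i \<in> \<sigma> \<longleftrightarrow> i \<in> \<rho>" for i
      unfolding indicator_vec_def vec_eq_iff vec_lambda_beta by (metis zero_neq_one)
    then show "\<sigma> = \<rho>" by blast
  qed
  have ort: "indicator_vec \<sigma> \<bullet> indicator_vec \<rho> = 0" if "\<sigma> \<in> \<Sigma>" "\<rho> \<in> \<Sigma>" "\<sigma> \<noteq> \<rho>" for \<sigma> \<rho>
    unfolding inner_indicator_vec using that disj by (intro sum.neutral) (auto simp: indicator_vec_def)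
  have ind: "independent (indicator_vec ` \<Sigma>)"
  proof (rule pairwise_orthogonal_independent)
    show "pairwise orthogonal (indicator_vec ` \<Sigma>)"
      using ort by (auto simp: pairwise_def orthogonal_def)
    show "0 \<notin> indicator_vec ` \<Sigma>"
    proof
      assume "0 \<in> (indicator_vec ` \<Sigma> :: (real ^ 'n) set)"
      then obtain \<sigma> where "\<sigma> \<in> \<Sigma>" "indicator_vec \<sigma> = (0 :: real ^ 'n)" by force
      moreover then obtain i where "i \<in> \<sigma>" using ne by blast
      ultimately show False
        unfolding indicator_vec_def vec_eq_iff vec_lambda_beta zero_index by (metis zero_neq_one)
    qed
  qed
  have "w \<in> span (indicator_vec ` \<Sigma>)" if w: "w \<in> W" for w
  proof -
    \<comment> \<open>The coefficient of a block is the value of \<open>w\<close> at any chosen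
      member, as \<open>w\<close> is constant there.\<close>
    have "w = (\<Sum>\<sigma>\<in>\<Sigma>. w $ (SOME i. i \<in> \<sigma>) *\<^sub>R indicator_vec \<sigma>)"
      unfolding vec_eq_iff
    proof
      fix i
      obtain \<tau> where \<tau>: "\<tau> \<in> \<Sigma>" "i \<in> \<tau>" using partition_onD1[OF P] by blast
      have "(\<Sum>\<sigma>\<in>\<Sigma>. w $ (SOME i. i \<in> \<sigma>) *\<^sub>R indicator_vec \<sigma>) $ i
          = (\<Sum>\<sigma>\<in>\<Sigma>. if \<sigma> = \<tau> then w $ (SOME i. i \<in> \<tau>) else 0)"
        unfolding sum_component using \<tau> disj by (intro sum.cong) (auto simp: indicator_vec_def)
      also have "\<dots> = w $ (SOME i. i \<in> \<tau>)" using \<tau> by simp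
      also have "\<dots> = w $ i" using w \<tau> someI[of "\<lambda>i. i \<in> \<tau>" i] unfolding W_def by blast
      finally show "w $ i = (\<Sum>\<sigma>\<in>\<Sigma>. w $ (SOME i. i \<in> \<sigma>) *\<^sub>R indicator_vec \<sigma>) $ i" ..
    qed
    also have "\<dots> \<in> span (indicator_vec ` \<Sigma>)"
      by (intro span_sum span_scale span_base imageI)
    finally show ?thesis .
  qed
  then have "W \<subseteq> span (indicator_vec ` \<Sigma>)" by blast
  moreover have "indicator_vec ` \<Sigma> \<subseteq> W"
  proof -
    have "(indicator_vec \<rho> :: real ^ 'n) $ u = indicator_vec \<rho> $ v"
      if "\<rho> \<in> \<Sigma>" "\<sigma> \<in> \<Sigma>" "u \<in> \<sigma>" "v \<in> \<sigma>" for \<rho> \<sigma> u v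
      using disj[of \<rho> \<sigma> u] disj[of \<rho> \<sigma> v] that by (auto simp: indicator_vec_def)
    then show ?thesis unfolding W_def image_subset_iff mem_Collect_eq by blast
  qed
  ultimately have "dim W = card (indicator_vec ` \<Sigma> :: (real ^ 'n) set)"
    using ind by (intro dim_unique[of "indicator_vec ` \<Sigma>"]) simp_all
  then show ?thesis unfolding W_def using card_image[OF inj] by simp
qed

text \<open>For small \<open>\<epsilon>\<close> the functional
  \<open>b = a + \<epsilon> *\<^sub>R w\<close> exposes a subface of the face of \<open>a\<close>.
  If \<open>w\<close> is constant on the latter, so is \<open>b\<close>; hence the center for
  \<open>a\<close> lies on the face of \<open>b\<close>, and \<open>b\<close> cannot separate ends
  that \<open>a\<close> leaves equal.\<close>

lemma level_face_inner_constant_iff: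
  fixes a w :: "real ^ 'n::finite"
  assumes G: "simple_graph (UNIV :: 'n set) E"
  shows "(\<forall>x\<in>level_face E a. w \<bullet> x = w \<bullet> face_center E a)
    \<longleftrightarrow> (\<forall>u v. {u, v} \<in> E \<and> a $ u = a $ v \<longrightarrow> w $ u = w $ v)"
proof
  assume const: "\<forall>x\<in>level_face E a. w \<bullet> x = w \<bullet> face_center E a"
  obtain \<epsilon> where \<epsilon>: "\<epsilon> > 0" "\<And>u v. a $ u < a $ v \<Longrightarrow> (a + \<epsilon> *\<^sub>R w) $ u < (a + \<epsilon> *\<^sub>R w) $ v"
    using perturbation_preserves_less[of a w] by blast
  define b where "b = a + \<epsilon> *\<^sub>R w"
  have "a $ u \<le> a $ v" if "b $ u \<le> b $ v" for u v
    using \<epsilon>(2)[of v u] that unfolding b_def by linarith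
  then have "level_face E b \<subseteq> level_face E a"
    unfolding level_face_subset_iff[OF G] level_closed_subset_iff by blast
  then have c: "face_center E b \<in> level_face E a" using face_center_mem_level_face[OF G] by blast
  then have "b \<bullet> face_center E b = b \<bullet> face_center E a"
    using const by (simp add: b_def inner_add_left level_face_def)
  then have "face_center E a \<in> level_face E b"
    using face_center_mem[OF G] by (simp add: level_face_def)
  then have *: "b $ u \<le> b $ v" if "{u, v} \<in> E" "a $ u \<le> a $ v" for u v
    using level_closed_subset_if_center_mem[OF G] that unfolding level_closed_subset_iff by blast
  show "\<forall>u v. {u, v} \<in> E \<and> a $ u = a $ v \<longrightarrow> w $ u = w $ v"
  proof (intro allI impI)
    fix u v assume uv: "{u, v} \<in> E \<and> a $ u = a $ v"
    then have "b $ u = b $ v" using *[of u v] *[of v u] by (simp add: insert_commute)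
    then show "w $ u = w $ v" using uv \<epsilon>(1) by (simp add: b_def)
  qed
qed (use level_face_inner_eq[OF G] in blast)

text \<open>The orthogonal complement of the direction space of the face consists of the vectors
  constant on the blocks, so its dimension is the number of blocks.\<close>

lemma aff_dim_level_face:
  fixes a :: "real ^ 'n::finite"
  assumes G: "simple_graph (UNIV :: 'n set) E"
  shows "aff_dim (level_face E a) = pao_dim UNIV E (level_orientation E (($) a))"
proof -
  define R where "R = {(p, q). {p, q} \<in> E \<and> a $ p = a $ q}"
  obtain \<Omega> where w: "pao_witness UNIV E (level_orientation E (($) a)) (UNIV // R\<^sup>*) \<Omega>"
    using level_orientation_pao_witness[OF G, of "($) a"] unfolding R_def by blast
  then have P: "partition_on UNIV (UNIV // R\<^sup>*)"
    by (simp add: pao_witness_def connected_partition_def)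
  define c where "c = face_center E a"
  \<comment> \<open>Translation by the center puts 0 into the set, so that its span is the direction
    space of the face.\<close>
  define D where "D = (+) (- c) ` level_face E a"
  have c: "c \<in> level_face E a" unfolding c_def by (rule face_center_mem_level_face[OF G])
  have "(\<forall>x\<in>span D. orthogonal x w) \<longleftrightarrow> (\<forall>\<sigma>\<in>UNIV // R\<^sup>*. \<forall>u\<in>\<sigma>. \<forall>v\<in>\<sigma>. w $ u = w $ v)" for w
  proof -
    have "(\<forall>x\<in>span D. orthogonal x w) \<longleftrightarrow> (\<forall>x\<in>D. orthogonal w x)"
      by (metis orthogonal_commute orthogonal_to_span span_base)
    also have "\<dots> \<longleftrightarrow> (\<forall>x\<in>level_face E a. w \<bullet> x = w \<bullet> c)"
      by (auto simp: D_def orthogonal_def inner_diff_right)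
    also have "\<dots> \<longleftrightarrow> (\<forall>(u, v)\<in>R. w $ u = w $ v)"
      unfolding c_def level_face_inner_constant_iff[OF G] R_def by blast
    \<comment> \<open>Constancy along single edges of equal value spreads along paths, hence over
      the connected blocks.\<close>
    also have "\<dots> \<longleftrightarrow> (\<forall>(u, v)\<in>R\<^sup>*. w $ u = w $ v)"
    proof (intro iffI; clarify)
      fix u v assume *: "\<forall>(u, v)\<in>R. w $ u = w $ v" and "(u, v) \<in> R\<^sup>*"
      from this(2) show "w $ u = w $ v" by induction (use * in auto)
    qed auto
    also have "\<dots> \<longleftrightarrow> (\<forall>\<sigma>\<in>UNIV // R\<^sup>*. \<forall>u\<in>\<sigma>. \<forall>v\<in>\<sigma>. w $ u = w $ v)"
    proof
      assume *: "\<forall>(u, v)\<in>R\<^sup>*. w $ u = w $ v"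
      show "\<forall>\<sigma>\<in>UNIV // R\<^sup>*. \<forall>u\<in>\<sigma>. \<forall>v\<in>\<sigma>. w $ u = w $ v"
      proof (intro ballI)
        fix \<sigma> u v assume "\<sigma> \<in> UNIV // R\<^sup>*" "u \<in> \<sigma>" "v \<in> \<sigma>"
        then obtain p where "(p, u) \<in> R\<^sup>*" "(p, v) \<in> R\<^sup>*" by (auto elim!: quotientE)
        then have "w $ p = w $ u" "w $ p = w $ v" using * by blast+
        then show "w $ u = w $ v" by simp
      qed
    next
      assume *: "\<forall>\<sigma>\<in>UNIV // R\<^sup>*. \<forall>u\<in>\<sigma>. \<forall>v\<in>\<sigma>. w $ u = w $ v"
      show "\<forall>(u, v)\<in>R\<^sup>*. w $ u = w $ v"
      proof clarify
        fix u v assume "(u, v) \<in> R\<^sup>*"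
        then have "R\<^sup>* `` {u} \<in> UNIV // R\<^sup>*" "u \<in> R\<^sup>* `` {u}" "v \<in> R\<^sup>* `` {u}"
          by (auto intro: quotientI)
        then show "w $ u = w $ v" using * by blast
      qed
    qed
    finally show ?thesis .
  qed
  then have "dim {w. \<forall>x\<in>span D. orthogonal x w} = card (UNIV // R\<^sup>*)"
    using dim_constant_on_blocks[OF P] by simp
  moreover have "dim {w \<in> UNIV. \<forall>x\<in>span D. orthogonal x w} + dim (span D) = dim (UNIV :: (real ^ 'n) set)"
    by (rule dim_subspace_orthogonal_to_vectors) auto
  ultimately have "card (UNIV // R\<^sup>*) + dim D = CARD('n)" by simp
  moreover have "aff_dim (level_face E a) = int (dim D)"
    unfolding D_def by (rule aff_dim_eq_dim) (use c in \<open>simp add: hull_inc\<close>)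
  ultimately show ?thesis
    unfolding pao_dim_def pao_witness_eqs(1)[OF G w] by simp
qed

section \<open>The correspondence between faces and orientations\<close>

theorem theorem2p15:
  fixes E :: "'n::finite set set"
  assumes "simple_graph (UNIV :: 'n set) E"
  shows "polytope (graph_polytope E) \<and>
    (\<exists>\<Phi>. bij_betw \<Phi> (nonempty_faces (graph_polytope E)) (paos UNIV E) \<and>
      (\<forall>F\<in>nonempty_faces (graph_polytope E). \<forall>F'\<in>nonempty_faces (graph_polytope E).
         F \<subseteq> F' \<longleftrightarrow> pao_le UNIV E (\<Phi> F) (\<Phi> F')) \<and>
      (\<forall>F\<in>nonempty_faces (graph_polytope E). aff_dim F = pao_dim UNIV E (\<Phi> F)))"
proof -
  note G = assms
  have card2: "card e = 2" if "e \<in> E" for e using G that by (simp add: simple_graph_def)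
  define \<phi> where "\<phi> a = level_orientation E (($) a)" for a :: "real ^ 'n"
  \<comment> \<open>Many functionals may expose the same face; by \<open>eq_iff\<close> they all
    induce the same orientation, and different faces get different ones.\<close>
  define \<Phi> where "\<Phi> F = \<phi> (SOME a. F = level_face E a)" for F
  have eq_iff: "level_face E a = level_face E b \<longleftrightarrow> \<phi> a = \<phi> b" for a b
  proof -
    have "level_face E a = level_face E b \<longleftrightarrow> level_closed E (($) a) = level_closed E (($) b)"
      unfolding set_eq_subset level_face_subset_iff[OF G] by blast
    then show ?thesis unfolding \<phi>_def using level_closed_eq_iff[OF card2] by blast
  qed
  have \<Phi>: "\<Phi> (level_face E a) = \<phi> a" for a
    unfolding \<Phi>_def eq_iff by (metis (mono_tags, lifting) someI_ex)
  have "bij_betw \<Phi> (range (level_face E)) (paos UNIV E)"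
  proof (rule bij_betw_imageI)
    show "inj_on \<Phi> (range (level_face E))"
      by (rule inj_onI) (metis \<Phi> eq_iff imageE)
    show "\<Phi> ` range (level_face E) = paos UNIV E"
    proof (intro equalityI subsetI)
      fix \<omega> assume "\<omega> \<in> \<Phi> ` range (level_face E)"
      then show "\<omega> \<in> paos UNIV E" using level_orientation_paos[OF G] by (auto simp: \<Phi> \<phi>_def)
    next
      fix \<omega> assume "\<omega> \<in> paos UNIV E"
      then obtain a where "\<omega> = level_orientation E a" using pao_is_level_orientation[OF G] by blast
      then have "\<omega> = \<Phi> (level_face E (\<chi> i. a i))" by (simp add: \<Phi> \<phi>_def vec_lambda_inverse)
      then show "\<omega> \<in> \<Phi> ` range (level_face E)" by blast
    qed
  qed
  moreover have "level_face E a \<subseteq> level_face E b \<longleftrightarrow> pao_le UNIV E (\<phi> a) (\<phi> b)" for a b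
    unfolding pao_le_def \<phi>_def pao_J_level_orientation[OF G] by (rule level_face_subset_iff[OF G])
  moreover have "aff_dim (level_face E a) = pao_dim UNIV E (\<phi> a)" for a
    unfolding \<phi>_def by (rule aff_dim_level_face[OF G])
  ultimately show ?thesis
    unfolding nonempty_faces_graph_polytope[OF G]
    by (intro conjI graph_polytope_polytope exI[of _ \<Phi>]) (auto simp: \<Phi>)
qed

end
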